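(* Let $\alpha>0$, $\alpha\ne1$, and consider a regular one-parameter $\mathbb{B}^{(\alpha)}$-family, $p_\theta(x)=[h(x)+F(\theta)+w(\theta)f(x)]^{\frac1{\alpha-1}}$ for $x\in\mathbb{S}$, $\theta\in\Theta\subset\mathbb{R}$. Let $p_\theta^*$ be the deformed probability distribution on $\mathbb{S}^n$ associated with the Basu et al. likelihood function, let $\overline f=\frac1n\sum_{i=1}^n f(x_i)$ and $\tau(\theta)=\mathbb{E}_\theta^*[\overline f]$. Then $\overline f$ is the best estimator of its expected value with respect to $p_\theta^*$. Furthermore, if $\widehat\theta$ is any estimator such that $\mathbb{E}_\theta^*[\widehat\theta]=\tau(\theta)$, then $$\mathrm{Var}_\theta^*[\widehat\theta]\ \ge\ \frac{[\tau'(\theta)]^2}{I_n^*(\theta)}.$$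
   Context: $\Theta\subset\mathbb{R}$ is open, $w:\Theta\to\mathbb{R}$ is differentiable, $f,h:\mathbb{R}\to\mathbb{R}$, $\mathbb{S}\subseteq\mathbb{R}$, $F:\Theta\to\mathbb{R}$ is the normalizing factor, and $p_\theta(x)=0$ for $x\notin\mathbb{S}$. Regular means: $\mathbb{S}$ does not depend on $\theta$; the functions $1,w$ are linearly independent; the functions $1,f$ are linearly independent. The deformed probability distribution is $$p_\theta^*(x_1^n)=\frac{\exp\big[\frac{\alpha}{n(\alpha-1)}\sum_{i=1}^n p_\theta(x_i)^{\alpha-1}\big]}{\int\exp\big[\frac{\alpha}{n(\alpha-1)}\sum_{i=1}^n p_\theta(y_i)^{\alpha-1}\big]dy_1^n},$$ assuming the denominator is finite (it is the normalization of $\exp[L_B^{(\alpha)}(x_1^n;\theta)]$, where $L_B^{(\alpha)}(x_1^n;\theta)=\frac1n\sum_{i=1}^n\big[\frac{\alpha p_\theta(x_i)^{\alpha-1}-1}{\alpha-1}\big]-\int p_\theta(x)^\alpha dx$). $\mathbb{E}_\theta^*,\mathrm{Var}_\theta^*$ are taken with respect to $p_\theta^*$. "$\overline f$ is the best estimator of its expected value with respect to $p_\theta^*$" means that every estimator $\widehat\theta(x_1^n)$ with $\mathbb{E}_\theta^*[\widehat\theta]=\mathbb{E}_\theta^*[\overline f]$ for all $\theta$ satisfies $\mathrm{Var}_\theta^*[\widehat\theta]\ge\mathrm{Var}_\theta^*[\overline f]$ for all $\theta$. $I_n^*(\theta)=\mathrm{Var}_\theta^*\big[\frac{\partial}{\partial\theta}\log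 p_\theta^*(X_1^n)\big]$ is the Fisher information of $p_\theta^*$.
   Formalization: It is additionally assumed that w is non-constant on some connected subset of Θ (automatic when Θ is an interval); for disconnected Θ with w constant on each component, the best-estimator claim can fail. *)

theory Defs
  imports "HOL-Probability.Probability"
begin

definition lin_indep_on :: "real set \<Rightarrow> (real \<Rightarrow> real) \<Rightarrow> (real \<Rightarrow> real) \<Rightarrow> bool" where
  "lin_indep_on A u v \<longleftrightarrow> (\<forall>a b. (\<forall>t\<in>A. a * u t + b * v t = 0) \<longrightarrow> a = 0 \<and> b = 0)"

definition B_density ::
  "real \<Rightarrow> real set \<Rightarrow> (real \<Rightarrow> real) \<Rightarrow> (real \<Rightarrow> real) \<Rightarrow> (real \<Rightarrow> real) \<Rightarrow> (real \<Rightarrow> real)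
    \<Rightarrow> real \<Rightarrow> real \<Rightarrow> real" where
  "B_density \<alpha> S h f w F \<theta> x =
     (if x \<in> S then (h x + F \<theta> + w \<theta> * f x) powr (1 / (\<alpha> - 1)) else 0)"

text \<open>
  The sign conditions say that the real power in \<^const>\<open>B_density\<close> is meaningful; the base may
  vanish only if the exponent is positive. That \<open>S\<close> does not depend on \<open>\<theta>\<close> is built into its type.
  Measurability of \<open>f\<close> and \<open>h\<close> on \<open>S\<close> follows from that of the densities, because \<open>w\<close> takes two
  distinct values; the values of \<open>f\<close> and \<open>h\<close> off \<open>S\<close> play no role.
\<close>

definition regular_B_family ::
  "real \<Rightarrow> real set \<Rightarrow> real set \<Rightarrow> (real \<Rightarrow> real) \<Rightarrow> (real \<Rightarrow> real) \<Rightarrow> (real \<Rightarrow> real)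
    \<Rightarrow> (real \<Rightarrow> real) \<Rightarrow> bool" where
  "regular_B_family \<alpha> \<Theta> S h f w F \<longleftrightarrow>
     open \<Theta> \<and> S \<in> sets borel \<and> w differentiable_on \<Theta> \<and>
     (\<forall>\<theta>\<in>\<Theta>. \<forall>x\<in>S. 0 \<le> h x + F \<theta> + w \<theta> * f x \<and> (\<alpha> < 1 \<longrightarrow> h x + F \<theta> + w \<theta> * f x \<noteq> 0)) \<and>
     (\<forall>\<theta>\<in>\<Theta>. has_bochner_integral lborel (B_density \<alpha> S h f w F \<theta>) 1) \<and>
     lin_indep_on \<Theta> (\<lambda>_. 1) w \<and> lin_indep_on S (\<lambda>_. 1) f"

text \<open>
  Samples \<open>x\<^sub>1, \<dots>, x\<^sub>n\<close> are the points of the product space \<open>S\<^sup>n\<close>, with indices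
  shifted to \<open>{..<n}\<close>.
\<close>

definition sample_space :: "real set \<Rightarrow> nat \<Rightarrow> (nat \<Rightarrow> real) measure" where
  "sample_space S n = PiM {..<n} (\<lambda>_. restrict_space lborel S)"

definition deformed_weight ::
  "real \<Rightarrow> (real \<Rightarrow> real \<Rightarrow> real) \<Rightarrow> nat \<Rightarrow> real \<Rightarrow> (nat \<Rightarrow> real) \<Rightarrow> real" where
  "deformed_weight \<alpha> p n \<theta> x =
     exp (\<alpha> / (real n * (\<alpha> - 1)) * (\<Sum>i<n. p \<theta> (x i) powr (\<alpha> - 1)))"

definition deformed_density ::
  "real \<Rightarrow> real set \<Rightarrow> (real \<Rightarrow> real \<Rightarrow> real) \<Rightarrow> nat \<Rightarrow> real \<Rightarrow> (nat \<Rightarrow> real) \<Rightarrow> real" where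
  "deformed_density \<alpha> S p n \<theta> x =
     deformed_weight \<alpha> p n \<theta> x / (\<integral>y. deformed_weight \<alpha> p n \<theta> y \<partial>sample_space S n)"

definition deformed_distr ::
  "real \<Rightarrow> real set \<Rightarrow> (real \<Rightarrow> real \<Rightarrow> real) \<Rightarrow> nat \<Rightarrow> real \<Rightarrow> (nat \<Rightarrow> real) measure" where
  "deformed_distr \<alpha> S p n \<theta> =
     density (sample_space S n) (\<lambda>x. ennreal (deformed_density \<alpha> S p n \<theta> x))"

text \<open>
  The variance takes values in \<open>[0, \<infinity>]\<close>, so that an integrable estimator that is not square
  integrable has infinite variance (the Bochner integral would give it variance \<open>0\<close>).
\<close>

definition Var :: "'a measure \<Rightarrow> ('a \<Rightarrow> real) \<Rightarrow> ennreal" where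
  "Var M X = (\<integral>\<^sup>+x. ennreal ((X x - (\<integral>y. X y \<partial>M))\<^sup>2) \<partial>M)"

definition has_expectation ::
  "(real \<Rightarrow> 'a measure) \<Rightarrow> real set \<Rightarrow> ('a \<Rightarrow> real) \<Rightarrow> (real \<Rightarrow> real) \<Rightarrow> bool" where
  "has_expectation P \<Theta> U \<tau> \<longleftrightarrow> (\<forall>\<theta>\<in>\<Theta>. integrable (P \<theta>) U \<and> (\<integral>x. U x \<partial>P \<theta>) = \<tau> \<theta>)"

definition best_estimator_of_mean ::
  "(real \<Rightarrow> 'a measure) \<Rightarrow> real set \<Rightarrow> ('a \<Rightarrow> real) \<Rightarrow> bool" where
  "best_estimator_of_mean P \<Theta> T \<longleftrightarrow>
     (\<forall>U. has_expectation P \<Theta> U (\<lambda>\<theta>. \<integral>x. T x \<partial>P \<theta>) \<longrightarrow>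
       (\<forall>\<theta>\<in>\<Theta>. Var (P \<theta>) U \<ge> Var (P \<theta>) T))"

definition deformed_fisher_info ::
  "real \<Rightarrow> real set \<Rightarrow> (real \<Rightarrow> real \<Rightarrow> real) \<Rightarrow> nat \<Rightarrow> real \<Rightarrow> ennreal" where
  "deformed_fisher_info \<alpha> S p n \<theta> =
     Var (deformed_distr \<alpha> S p n \<theta>) (\<lambda>x. deriv (\<lambda>t. ln (deformed_density \<alpha> S p n t x)) \<theta>)"

definition sample_mean :: "(real \<Rightarrow> real) \<Rightarrow> nat \<Rightarrow> (nat \<Rightarrow> real) \<Rightarrow> real" where
  "sample_mean f n x = (\<Sum>i<n. f (x i)) / real n"

end

theory Submission
  imports Defs "HOL-Complex_Analysis.Conformal_Mappings"
begin

text \<open>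
  On the support the power \<open>p\<^sub>\<theta> powr (\<alpha> - 1)\<close> is \<open>h + F(\<theta>) + w(\<theta>) f\<close>, so the deformed family is an
  ordinary exponential family with statistic \<open>T = f\<close>-mean and natural parameter
  \<open>s(\<theta>) = \<alpha> w(\<theta>) / (\<alpha> - 1)\<close>; the factor \<open>F\<close> cancels. The values of \<open>s\<close> contain an interval, so \<open>T\<close> is
  complete: if \<open>U\<close> and \<open>T\<close> have the same means, then \<open>U - T\<close> has vanishing Laplace transform along
  \<open>T\<close>, hence is orthogonal to all functions of \<open>T\<close>, and \<open>Var U \<ge> Var T\<close>. Moreover
  \<open>\<tau>' = s' Var T\<close> and the score is \<open>s' (T - \<tau>)\<close>, so the information bound is \<open>Var T\<close>, or \<open>0\<close> if
  \<open>s' = 0\<close> or \<open>Var T = 0\<close>.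
\<close>

section \<open>Uniqueness of Fourier and Laplace transforms along a statistic\<close>

text \<open>The positive and negative parts of \<open>V\<close> have equal mass, by the frequency
  \<open>u = 0\<close>. Normalized and pushed forward along \<open>T\<close>, they become
  probability laws on the line with equal characteristic functions, hence the same law by Levy
  uniqueness; so \<open>\<psi>\<close> has the same integral against both.\<close>

lemma fourier_zero_imp_orthogonal:
  fixes V T :: "'a \<Rightarrow> real" and \<psi> :: "real \<Rightarrow> real"
  assumes V: "integrable M V" and T [measurable]: "T \<in> borel_measurable M"
    and zero: "\<And>u. (\<integral>x. V x *\<^sub>R iexp (u * T x) \<partial>M) = 0"
    and \<psi> [measurable]: "\<psi> \<in> borel_measurable borel"
    and int: "integrable M (\<lambda>x. V x * \<psi> (T x))"
  shows "(\<integral>x. V x * \<psi> (T x) \<partial>M) = 0"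
proof -
  have V_meas [measurable]: "V \<in> borel_measurable M" using V by auto
  define pos neg where "pos = (\<lambda>x. max (V x) 0)" and "neg = (\<lambda>x. max (- V x) 0)"
  have pos_neg: "V x = pos x - neg x" "0 \<le> pos x" "0 \<le> neg x" "pos x \<le> \<bar>V x\<bar>" "neg x \<le> \<bar>V x\<bar>" for x
    by (auto simp: pos_def neg_def)
  have [measurable]: "pos \<in> borel_measurable M" "neg \<in> borel_measurable M"
    by (auto simp: pos_def neg_def)
  \<comment> \<open>The values of \<open>g\<close> lie in a Banach space because real test
    functions, the constant 1 and complex exponentials all occur.\<close>
  have parts_int: "integrable M (\<lambda>x. pos x *\<^sub>R g x)" "integrable M (\<lambda>x. neg x *\<^sub>R g x)"
    if "integrable M (\<lambda>x. V x *\<^sub>R g x)" and [measurable]: "g \<in> borel_measurable M"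
    for g :: "'a \<Rightarrow> 'b::{banach, second_countable_topology}"
    by (rule Bochner_Integration.integrable_bound[OF that(1)]; use pos_neg in \<open>auto intro!: AE_I2 mult_right_mono\<close>)+
  have int_V_iexp: "integrable M (\<lambda>x. V x *\<^sub>R iexp (u * T x))" for u
    by (rule Bochner_Integration.integrable_bound[OF V]) auto
  define m where "m = (\<integral>x. pos x \<partial>M)"
  have int_pos: "integrable M pos" and int_neg: "integrable M neg"
    using parts_int[of "\<lambda>_. 1::real"] V by auto
  have "(\<integral>x. V x \<partial>M) = 0"
  proof -
    have "complex_of_real (\<integral>x. V x \<partial>M) = 0"
      using zero[of 0] by (simp add: scaleR_conv_of_real)
    then show ?thesis by simp
  qed
  then have m_neg: "(\<integral>x. neg x \<partial>M) = m"
    using int_pos int_neg by (simp add: m_def pos_neg(1))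
  show ?thesis
  \<comment> \<open>For \<open>m = 0\<close> there is nothing to normalize, but then
    \<open>V\<close> vanishes almost everywhere.\<close>
  proof (cases "m = 0")
    case True
    have "AE x in M. pos x = 0" "AE x in M. neg x = 0"
      using True m_neg
        integral_nonneg_eq_0_iff_AE[OF int_pos AE_I2[OF pos_neg(2)]]
        integral_nonneg_eq_0_iff_AE[OF int_neg AE_I2[OF pos_neg(3)]]
      by (simp_all add: m_def)
    then have "AE x in M. V x * \<psi> (T x) = 0"
      by eventually_elim (simp add: pos_neg(1))
    then show ?thesis
      by (subst integral_cong_AE[where g = "\<lambda>_. 0"]) auto
  next
    case False
    have "0 \<le> m" unfolding m_def using pos_neg by (intro Bochner_Integration.integral_nonneg) auto
    with False have m_pos: "0 < m" by simp
    define law where "law = (\<lambda>g. distr (density M (\<lambda>x. ennreal (g x / m))) borel T)"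
    have law_integral: "(\<integral>t. k t \<partial>law g) = (\<integral>x. g x *\<^sub>R k (T x) \<partial>M) /\<^sub>R m"
      if [measurable]: "g \<in> borel_measurable M" "k \<in> borel_measurable borel" and "\<And>x. 0 \<le> g x"
      for g and k :: "real \<Rightarrow> 'b::{banach, second_countable_topology}"
    proof -
      have "(\<integral>t. k t \<partial>law g) = (\<integral>x. (g x / m) *\<^sub>R k (T x) \<partial>M)"
        unfolding law_def using m_pos that by (simp add: integral_distr integral_density)
      also have "\<dots> = (\<integral>x. (1 / m) *\<^sub>R (g x *\<^sub>R k (T x)) \<partial>M)"
        by simp
      also have "\<dots> = (1 / m) *\<^sub>R (\<integral>x. g x *\<^sub>R k (T x) \<partial>M)"
        by (rule integral_scaleR_right)
      finally show ?thesis by (simp add: divide_inverse)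
    qed
    have law_real_distribution: "real_distribution (law g)"
      if [measurable]: "g \<in> borel_measurable M" and "\<And>x. 0 \<le> g x" "integrable M g" "(\<integral>x. g x \<partial>M) = m" for g
    proof -
      have "emeasure (density M (\<lambda>x. ennreal (g x / m))) (space M) = (\<integral>\<^sup>+x. ennreal (g x / m) \<partial>M)"
        by (subst emeasure_density) (auto intro!: nn_integral_cong)
      also have "\<dots> = ennreal (\<integral>x. g x / m \<partial>M)"
        using that m_pos by (intro nn_integral_eq_integral) auto
      finally have "prob_space (density M (\<lambda>x. ennreal (g x / m)))"
        using that m_pos by (intro prob_spaceI) simp
      then show ?thesis
        unfolding law_def by (intro prob_space.real_distribution_distr) auto
    qed
    have laws: "real_distribution (law pos)" "real_distribution (law neg)"
      using law_real_distribution pos_neg int_pos int_neg m_neg by (auto simp: m_def)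
    have "char (law pos) u = char (law neg) u" for u
    proof -
      note i = parts_int[OF int_V_iexp[of u]]
      have "(\<integral>x. pos x *\<^sub>R iexp (u * T x) \<partial>M) - (\<integral>x. neg x *\<^sub>R iexp (u * T x) \<partial>M)
          = (\<integral>x. V x *\<^sub>R iexp (u * T x) \<partial>M)"
        using i by (subst Bochner_Integration.integral_diff[symmetric]) (auto simp: pos_neg(1) algebra_simps)
      then show ?thesis using zero[of u] pos_neg
        unfolding char_def by (simp add: law_integral)
    qed
    then have law_eq: "law pos = law neg"
      by (intro Levy_uniqueness laws ext)
    have "(\<integral>x. V x * \<psi> (T x) \<partial>M) = (\<integral>x. pos x *\<^sub>R \<psi> (T x) \<partial>M) - (\<integral>x. neg x *\<^sub>R \<psi> (T x) \<partial>M)"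
      using parts_int[of "\<lambda>x. \<psi> (T x)"] int
      by (subst Bochner_Integration.integral_diff[symmetric]) (auto simp: pos_neg(1) algebra_simps)
    also have "\<dots> = m * ((\<integral>t. \<psi> t \<partial>law pos) - (\<integral>t. \<psi> t \<partial>law neg))"
      using pos_neg m_pos by (simp add: law_integral field_simps)
    finally show ?thesis by (simp add: law_eq)
  qed
qed

text \<open>The mean value inequality on the disc of radius \<open>norm (z * t)\<close> about 0,
  where \<open>exp (norm z * \<bar>t\<bar>)\<close> bounds the derivative of
  \<open>exp\<close>.\<close>

lemma norm_exp_diff_quotient_le:
  fixes z :: complex and t :: real
  assumes "z \<noteq> 0"
  shows "norm ((exp (z * t) - 1) / z) \<le> \<bar>t\<bar> * exp (norm z * \<bar>t\<bar>)"
proof -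
  have "norm (exp (z * t) - exp 0) \<le> exp (norm z * \<bar>t\<bar>) * norm (z * t - 0)"
  proof (rule field_differentiable_bound[where S = "cball 0 (norm (z * t))" and f' = exp])
    fix y :: complex assume "y \<in> cball 0 (norm (z * t))"
    then have "norm y \<le> norm z * \<bar>t\<bar>" by (simp add: norm_mult)
    then show "norm (exp y) \<le> exp (norm z * \<bar>t\<bar>)"
      using norm_exp[of y] by (meson exp_le_cancel_iff order_trans)
  qed (auto intro!: derivative_eq_intros simp: DERIV_exp DERIV_subset)
  then show ?thesis using assms
    by (simp add: norm_divide norm_mult field_simps)
qed

text \<open>A linear factor costs only a doubling of the exponent, since
  \<open>r * \<bar>t\<bar>\<close> is below its own exponential. The right side has no absolute
  value left, so integrability of real exponential weights applies to it.\<close>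

lemma abs_times_exp_le:
  fixes r t :: real assumes "0 < r"
  shows "\<bar>t\<bar> * exp (r * \<bar>t\<bar>) \<le> (exp (2 * r * t) + exp (- 2 * r * t)) / r"
proof -
  have "r * \<bar>t\<bar> \<le> exp (r * \<bar>t\<bar>)"
    using exp_ge_add_one_self[of "r * \<bar>t\<bar>"] by linarith
  then have "r * \<bar>t\<bar> * exp (r * \<bar>t\<bar>) \<le> exp (r * \<bar>t\<bar>) * exp (r * \<bar>t\<bar>)"
    by (intro mult_right_mono) auto
  also have "\<dots> = exp (2 * r * \<bar>t\<bar>)" by (simp flip: exp_add)
  also have "\<dots> \<le> exp (2 * r * t) + exp (- 2 * r * t)"
    by (auto simp: abs_if)
  finally show ?thesis using assms by (simp add: field_simps)
qed

text \<open>Differentiation under the integral by dominated convergence: near a point of the strip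
  the difference quotients are bounded by two real exponentials whose parameters still lie between
  \<open>a\<close> and \<open>b\<close>.\<close>

lemma laplace_holomorphic_on_strip:
  fixes V T :: "'a \<Rightarrow> real"
  assumes [measurable]: "V \<in> borel_measurable M" "T \<in> borel_measurable M"
    and int: "\<And>s. a < s \<Longrightarrow> s < b \<Longrightarrow> integrable M (\<lambda>x. V x * exp (s * T x))"
  shows "(\<lambda>z. \<integral>x. V x *\<^sub>R exp (z * complex_of_real (T x)) \<partial>M) holomorphic_on {z. a < Re z \<and> Re z < b}"
    (is "?\<Phi> holomorphic_on ?H")
proof -
  have "open ?H"
    using open_Int[OF open_halfspace_Re_gt[of a] open_halfspace_Re_lt[of b]] by (simp add: Int_def)
  have int_exp: "integrable M (\<lambda>x. V x *\<^sub>R exp (z * complex_of_real (T x)))" if "z \<in> ?H" for z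
    using that by (intro Bochner_Integration.integrable_bound[OF int[of "Re z"]]) (auto simp: abs_mult)
  have "(?\<Phi> has_field_derivative (\<integral>x. V x *\<^sub>R (exp (z * T x) * T x) \<partial>M)) (at z within ?H)"
    if z: "z \<in> ?H" for z
  proof -
    \<comment> \<open>A quarter of the distance to the boundary leaves room for the doubled exponent
      in \<open>abs_times_exp_le\<close>.\<close>
    define r where "r = min (Re z - a) (b - Re z) / 4"
    have "r > 0" and r: "a < Re z - 2 * r" "Re z + 2 * r < b" using z by (auto simp: r_def min_def field_simps)
    define dom where "dom = (\<lambda>x. \<bar>V x * exp ((Re z + 2 * r) * T x)\<bar> / r + \<bar>V x * exp ((Re z - 2 * r) * T x)\<bar> / r)"
    have dom_int: "integrable M dom"
      unfolding dom_def using r \<open>r > 0\<close>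
      by (intro Bochner_Integration.integrable_add integrable_divide integrable_abs int) auto
    have dom_bound: "norm (V x *\<^sub>R (exp (z * T x) * ((exp (d * complex_of_real (T x)) - 1) / d))) \<le> dom x"
      if d: "d \<noteq> 0" "norm d \<le> r" for d :: complex and x
    proof -
      have "norm ((exp (d * complex_of_real (T x)) - 1) / d) \<le> \<bar>T x\<bar> * exp (norm d * \<bar>T x\<bar>)"
        by (rule norm_exp_diff_quotient_le[OF d(1)])
      also have "\<dots> \<le> \<bar>T x\<bar> * exp (r * \<bar>T x\<bar>)"
        using d by (intro mult_left_mono) (auto intro: mult_right_mono)
      also have "\<dots> \<le> (exp (2 * r * T x) + exp (- 2 * r * T x)) / r"
        by (rule abs_times_exp_le[OF \<open>r > 0\<close>])
      finally have *: "norm ((exp (d * complex_of_real (T x)) - 1) / d) \<le> \<dots>" .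
      have "norm (V x *\<^sub>R (exp (z * T x) * ((exp (d * complex_of_real (T x)) - 1) / d)))
          = (\<bar>V x\<bar> * exp (Re z * T x)) * norm ((exp (d * complex_of_real (T x)) - 1) / d)"
        by (simp only: norm_scaleR norm_mult norm_exp_eq_Re) simp
      also have "\<dots> \<le> (\<bar>V x\<bar> * exp (Re z * T x)) * ((exp (2 * r * T x) + exp (- 2 * r * T x)) / r)"
        by (intro mult_left_mono *) auto
      also have "\<dots> = dom x"
        by (simp add: dom_def abs_mult distrib_left distrib_right add_divide_distrib exp_add left_diff_distrib exp_diff exp_minus divide_inverse)
      finally show ?thesis .
    qed
    show ?thesis
      unfolding has_field_derivative_iff tendsto_at_iff_sequentially comp_def
    proof (intro allI impI)
      fix X :: "nat \<Rightarrow> complex"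
      assume X: "\<forall>i. X i \<in> ?H - {z}" "X \<longlonglongrightarrow> z"
      define d where "d = (\<lambda>i. X i - z)"
      have d: "d \<longlonglongrightarrow> 0" unfolding d_def using X(2) by (simp add: LIM_zero_iff)
      have d_nz: "d i \<noteq> 0" for i using X(1) by (auto simp: d_def)
      obtain N where N: "\<And>i. i \<ge> N \<Longrightarrow> norm (d i) \<le> r"
        using LIMSEQ_D[OF d \<open>r > 0\<close>] by (force intro: less_imp_le)
      have quot: "(?\<Phi> (X i) - ?\<Phi> z) / (X i - z)
          = (\<integral>x. V x *\<^sub>R (exp (z * T x) * ((exp (d i * complex_of_real (T x)) - 1) / d i)) \<partial>M)" for i
      proof -
        have "(?\<Phi> (X i) - ?\<Phi> z) / (X i - z)
            = (\<integral>x. (V x *\<^sub>R exp (X i * T x) - V x *\<^sub>R exp (z * T x)) / (X i - z) \<partial>M)"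
          using int_exp X(1) z by (subst Bochner_Integration.integral_diff[symmetric]) auto
        also have "\<dots> = (\<integral>x. V x *\<^sub>R (exp (z * T x) * ((exp (d i * complex_of_real (T x)) - 1) / d i)) \<partial>M)"
        proof (rule Bochner_Integration.integral_cong[OF refl])
          fix x
          have "exp (X i * T x) = exp (z * T x) * exp (d i * T x)"
            by (simp add: d_def algebra_simps flip: exp_add)
          then show "(V x *\<^sub>R exp (X i * T x) - V x *\<^sub>R exp (z * T x)) / (X i - z)
            = V x *\<^sub>R (exp (z * T x) * ((exp (d i * complex_of_real (T x)) - 1) / d i))"
            by (simp add: d_def scaleR_conv_of_real algebra_simps)
        qed
        finally show ?thesis .
      qed
      \<comment> \<open>\<open>dom_bound\<close> applies only once
        \<open>norm (d i) \<le> r\<close>, so the sequence starts at \<open>N\<close>;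
        \<open>LIMSEQ_offset\<close> removes the shift.\<close>
      have "(\<lambda>i. \<integral>x. V x *\<^sub>R (exp (z * T x) * ((exp (d (i + N) * complex_of_real (T x)) - 1) / d (i + N))) \<partial>M)
          \<longlonglongrightarrow> (\<integral>x. V x *\<^sub>R (exp (z * T x) * T x) \<partial>M)"
      proof (rule integral_dominated_convergence[OF _ _ dom_int])
        show "AE x in M. (\<lambda>i. V x *\<^sub>R (exp (z * T x) * ((exp (d (i + N) * complex_of_real (T x)) - 1) / d (i + N))))
            \<longlonglongrightarrow> V x *\<^sub>R (exp (z * T x) * T x)"
        proof (rule AE_I2)
          fix x
          have "((\<lambda>y. exp (y * complex_of_real (T x))) has_field_derivative complex_of_real (T x)) (at 0)"
            by (auto intro!: derivative_eq_intros)
          then have "((\<lambda>y. (exp (y * complex_of_real (T x)) - 1) / y) \<longlongrightarrow> T x) (at 0)"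
            by (simp add: has_field_derivative_iff)
          then have "(\<lambda>i. (exp (d (i + N) * complex_of_real (T x)) - 1) / d (i + N)) \<longlonglongrightarrow> T x"
            using LIMSEQ_ignore_initial_segment[OF d, of N] d_nz
            by (auto simp: tendsto_at_iff_sequentially comp_def)
          then show "(\<lambda>i. V x *\<^sub>R (exp (z * T x) * ((exp (d (i + N) * complex_of_real (T x)) - 1) / d (i + N))))
            \<longlonglongrightarrow> V x *\<^sub>R (exp (z * T x) * T x)"
            by (intro tendsto_intros)
        qed
        show "AE x in M. norm (V x *\<^sub>R (exp (z * T x) * ((exp (d (i + N) * complex_of_real (T x)) - 1) / d (i + N)))) \<le> dom x" for i
          using dom_bound[OF d_nz N[of "i + N"]] by auto
      qed measurable
      then show "(\<lambda>i. (?\<Phi> (X i) - ?\<Phi> z) / (X i - z)) \<longlonglongrightarrow> (\<integral>x. V x *\<^sub>R (exp (z * T x) * T x) \<partial>M)"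
        unfolding quot by (rule LIMSEQ_offset)
    qed
  qed
  then show ?thesis
    unfolding holomorphic_on_def field_differentiable_def by blast
qed

text \<open>The Laplace transform extends holomorphically to the strip; vanishing on a real interval, it
  vanishes on the vertical line through the midpoint, where it is a Fourier transform.\<close>

lemma laplace_zero_imp_orthogonal:
  fixes V T :: "'a \<Rightarrow> real" and \<phi> :: "real \<Rightarrow> real"
  assumes [measurable]: "V \<in> borel_measurable M" "T \<in> borel_measurable M" "\<phi> \<in> borel_measurable borel"
    and "a < b"
    and int: "\<And>s. a < s \<Longrightarrow> s < b \<Longrightarrow> integrable M (\<lambda>x. V x * exp (s * T x))"
    and zero: "\<And>s. a < s \<Longrightarrow> s < b \<Longrightarrow> (\<integral>x. V x * exp (s * T x) \<partial>M) = 0"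
    and int_\<phi>: "integrable M (\<lambda>x. V x * \<phi> (T x))"
  shows "(\<integral>x. V x * \<phi> (T x) \<partial>M) = 0"
proof -
  define \<Phi> where "\<Phi> = (\<lambda>z. \<integral>x. V x *\<^sub>R exp (z * complex_of_real (T x)) \<partial>M)"
  define H where "H = {z. a < Re z \<and> Re z < b}"
  define s where "s = (a + b) / 2"
  have s: "a < s" "s < b" using \<open>a < b\<close> by (auto simp: s_def)
  have hol: "\<Phi> holomorphic_on H"
    unfolding \<Phi>_def H_def by (rule laplace_holomorphic_on_strip) (use int in auto)
  have H: "open H" "connected H"
  proof -
    have *: "H = {z. a < Re z} \<inter> {z. Re z < b}" by (auto simp: H_def)
    show "open H" unfolding * by (intro open_Int open_halfspace_Re_gt open_halfspace_Re_lt)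
    have "convex H" unfolding * by (intro convex_Int convex_halfspace_Re_gt convex_halfspace_Re_lt)
    then show "connected H" by (rule convex_connected)
  qed
  have \<Phi>_real: "\<Phi> (complex_of_real t) = 0" if "a < t" "t < b" for t
  proof -
    have "\<Phi> (complex_of_real t) = (\<integral>x. complex_of_real (V x * exp (t * T x)) \<partial>M)"
      unfolding \<Phi>_def by (intro Bochner_Integration.integral_cong) (auto simp: scaleR_conv_of_real simp flip: exp_of_real)
    also have "\<dots> = complex_of_real (\<integral>x. V x * exp (t * T x) \<partial>M)"
      by (rule integral_complex_of_real)
    finally show ?thesis using zero[OF that] by simp
  qed
  have \<Phi>_zero: "\<Phi> z = 0" if "z \<in> H" for z
  proof (rule analytic_continuation[OF hol H, where U = "complex_of_real ` {a<..<b}" and \<xi> = "complex_of_real s"])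
    have "s islimpt {a<..<b}"
      using s by (intro interior_limit_point) (simp add: interior_open)
    then show "complex_of_real s islimpt complex_of_real ` {a<..<b}"
      by (auto simp: islimpt_approachable dist_of_real)
  qed (use that s \<Phi>_real in \<open>auto simp: H_def\<close>)
  \<comment> \<open>The Fourier lemma is applied to the tilted function
    \<open>V x * exp (s * T x)\<close>, whose Fourier transform is \<open>\<Phi>\<close> on the
    vertical line through \<open>s\<close>; the test function absorbs the inverse tilt.\<close>
  have tilt: "(V x * exp (s * T x)) * (\<phi> (T x) * exp (- s * T x)) = V x * \<phi> (T x)" for x
    by (simp add: exp_minus field_simps)
  have "(\<integral>x. (V x * exp (s * T x)) * (\<phi> (T x) * exp (- s * T x)) \<partial>M) = 0"
  proof (rule fourier_zero_imp_orthogonal[where \<psi> = "\<lambda>t. \<phi> t * exp (- s * t)"])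
    fix u
    have "(\<integral>x. (V x * exp (s * T x)) *\<^sub>R iexp (u * T x) \<partial>M) = \<Phi> (complex_of_real s + \<i> * complex_of_real u)"
      unfolding \<Phi>_def
      by (intro Bochner_Integration.integral_cong) (auto simp: scaleR_conv_of_real exp_add algebra_simps simp flip: exp_of_real)
    then show "(\<integral>x. (V x * exp (s * T x)) *\<^sub>R iexp (u * T x) \<partial>M) = 0"
      using s by (simp add: \<Phi>_zero H_def)
    show "integrable M (\<lambda>x. (V x * exp (s * T x)) * (\<phi> (T x) * exp (- s * T x)))"
      unfolding tilt by (rule int_\<phi>)
  qed (use int s in auto)
  then show ?thesis unfolding tilt .
qed

section \<open>Exponential families and the optimality of their statistic\<close>

text \<open>The moment generating function of \<open>T\<close>, with \<open>M\<close> allowed to be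
  infinite. The Bochner integral gives 0 where it diverges, so positivity records convergence as
  well as nontriviality.\<close>

definition partition_fun :: "'a measure \<Rightarrow> ('a \<Rightarrow> real) \<Rightarrow> real \<Rightarrow> real" where
  "partition_fun M T s = (\<integral>x. exp (s * T x) \<partial>M)"

definition exp_family :: "'a measure \<Rightarrow> ('a \<Rightarrow> real) \<Rightarrow> real \<Rightarrow> 'a measure" where
  "exp_family M T s = density M (\<lambda>x. ennreal (exp (s * T x) / partition_fun M T s))"

lemma sets_exp_family [simp, measurable_cong]: "sets (exp_family M T s) = sets M"
  and space_exp_family [simp]: "space (exp_family M T s) = space M"
  by (simp_all add: exp_family_def)

lemma partition_fun_nonneg: "0 \<le> partition_fun M T s"
  unfolding partition_fun_def by (rule Bochner_Integration.integral_nonneg) simp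

lemma partition_fun_pos:
  assumes "integrable M (\<lambda>x. exp (s * T x))" "emeasure M (space M) \<noteq> 0"
  shows "0 < partition_fun M T s"
proof -
  have "partition_fun M T s \<noteq> 0"
  proof
    assume "partition_fun M T s = 0"
    then have "AE x in M. exp (s * T x) = 0"
      unfolding partition_fun_def using assms(1) by (subst (asm) integral_nonneg_eq_0_iff_AE) auto
    then have "AE x in M. False" by simp
    with assms(2) show False by (simp add: AE_iff_measurable[of "space M" M "\<lambda>_. False"])
  qed
  with partition_fun_nonneg[of M T s] show ?thesis by simp
qed

lemma integrable_exp_family:
  fixes U :: "'a \<Rightarrow> real"
  assumes [measurable]: "T \<in> borel_measurable M" "U \<in> borel_measurable M"
    and "0 < partition_fun M T s"
  shows "integrable (exp_family M T s) U \<longleftrightarrow> integrable M (\<lambda>x. U x * exp (s * T x))"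
proof -
  have "integrable (exp_family M T s) U \<longleftrightarrow> integrable M (\<lambda>x. U x * exp (s * T x) / partition_fun M T s)"
    unfolding exp_family_def using assms(3)
    by (subst integrable_density) (auto simp: mult.commute intro!: arg_cong[where f = "integrable M"])
  then show ?thesis using assms(3) by (simp add: divide_inverse)
qed

lemma integral_exp_family:
  fixes U :: "'a \<Rightarrow> real"
  assumes [measurable]: "T \<in> borel_measurable M" "U \<in> borel_measurable M"
  shows "(\<integral>x. U x \<partial>exp_family M T s) = (\<integral>x. U x * exp (s * T x) \<partial>M) / partition_fun M T s"
  unfolding exp_family_def using partition_fun_nonneg[of M T s]
  by (subst integral_density) (auto simp: mult.commute simp flip: integral_divide_zero)

lemma prob_space_exp_family:
  assumes [measurable]: "T \<in> borel_measurable M"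
    and "integrable M (\<lambda>x. exp (s * T x))" "0 < partition_fun M T s"
  shows "prob_space (exp_family M T s)"
proof (rule prob_spaceI)
  have "emeasure (exp_family M T s) (space M) = (\<integral>\<^sup>+x. ennreal (exp (s * T x) / partition_fun M T s) \<partial>M)"
    unfolding exp_family_def by (subst emeasure_density) (auto intro!: nn_integral_cong)
  also have "\<dots> = ennreal (\<integral>x. exp (s * T x) / partition_fun M T s \<partial>M)"
    using assms by (intro nn_integral_eq_integral) auto
  also have "\<dots> = 1" using assms(3) by (simp add: partition_fun_def)
  finally show "emeasure (exp_family M T s) (space (exp_family M T s)) = 1" by simp
qed

text \<open>Let \<open>\<mu>\<close> be the mean of \<open>T\<close>. Completeness makes \<open>U - T\<close> orthogonal to \<open>(T - \<mu>) 1(\<bar>T\<bar> \<le> k)\<close>, so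
  the truncated variance of \<open>T\<close> is at most the variance of \<open>U\<close>. Truncating also covers the case
  that \<open>T\<close> has infinite variance.\<close>

lemma exp_family_best_estimator:
  fixes T U :: "'a \<Rightarrow> real"
  assumes T [measurable]: "T \<in> borel_measurable M" and nonnull: "emeasure M (space M) \<noteq> 0"
    and "a < b" "{a<..<b} \<subseteq> W"
    and int_exp: "\<And>r. r \<in> W \<Longrightarrow> integrable M (\<lambda>x. exp (r * T x))"
    and int_T: "\<And>r. r \<in> W \<Longrightarrow> integrable (exp_family M T r) T"
    and int_U: "\<And>r. r \<in> W \<Longrightarrow> integrable (exp_family M T r) U"
    and mean: "\<And>r. r \<in> W \<Longrightarrow> (\<integral>x. U x \<partial>exp_family M T r) = (\<integral>x. T x \<partial>exp_family M T r)"
    and s: "s \<in> W"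
  shows "Var (exp_family M T s) T \<le> Var (exp_family M T s) U"
proof -
  define P where "P = exp_family M T s"
  define \<mu> where "\<mu> = (\<integral>x. T x \<partial>P)"
  define V where "V = (\<lambda>x. U x - T x)"
  have sets_P [measurable_cong]: "sets P = sets M" by (simp add: P_def)
  have pos: "0 < partition_fun M T r" if "r \<in> W" for r
    using partition_fun_pos[OF int_exp[OF that] nonnull] .
  interpret P: prob_space P
    unfolding P_def using s by (intro prob_space_exp_family int_exp pos T)
  have U [measurable]: "U \<in> borel_measurable M"
    using borel_measurable_integrable[OF int_U[OF s]] by simp
  have V [measurable]: "V \<in> borel_measurable M" by (simp add: V_def)
  have V_int: "integrable M (\<lambda>x. V x * exp (r * T x))"
    and V_zero: "(\<integral>x. V x * exp (r * T x) \<partial>M) = 0" if "r \<in> W" for r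
  proof -
    note ints = int_U[OF that] int_T[OF that]
    have "integrable (exp_family M T r) V" "(\<integral>x. V x \<partial>exp_family M T r) = 0"
      using ints mean[OF that] by (simp_all add: V_def)
    then show "integrable M (\<lambda>x. V x * exp (r * T x))" "(\<integral>x. V x * exp (r * T x) \<partial>M) = 0"
      using pos[OF that] by (simp_all add: integrable_exp_family integral_exp_family)
  qed
  define c where "c = (\<lambda>(k::nat) x. indicator {- real k..real k} (T x) :: real)"
  have c_meas [measurable]: "c k \<in> borel_measurable M" for k by (simp add: c_def)
  have c_bounds: "0 \<le> c k x" "c k x \<le> 1" for k x by (auto simp: c_def indicator_def)
  have c_dev: "\<bar>c k x * (T x - \<mu>)\<bar> \<le> real k + \<bar>\<mu>\<bar>" for k x
    by (auto simp: c_def indicator_def)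
  have orth: "integrable P (\<lambda>x. V x * (c k x * (T x - \<mu>)))" "(\<integral>x. V x * (c k x * (T x - \<mu>)) \<partial>P) = 0" for k
  proof -
    \<comment> \<open>Orthogonality is wanted under \<open>P\<close> but available under
      \<open>M\<close>, so the test function carries \<open>exp (s * t)\<close>, which is the
      density of \<open>P\<close> up to a constant.\<close>
    define \<phi> where "\<phi> = (\<lambda>t. indicator {- real k..real k} t * (t - \<mu>) * exp (s * t))"
    have eq: "V x * \<phi> (T x) = V x * (c k x * (T x - \<mu>)) * exp (s * T x)" for x
      by (simp add: \<phi>_def c_def)
    have int: "integrable M (\<lambda>x. V x * \<phi> (T x))"
    proof (rule Bochner_Integration.integrable_bound)
      show "integrable M (\<lambda>x. (real k + \<bar>\<mu>\<bar>) * (V x * exp (s * T x)))"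
        using V_int[OF s] by simp
      have "norm (V x * \<phi> (T x)) = \<bar>c k x * (T x - \<mu>)\<bar> * (\<bar>V x\<bar> * exp (s * T x))" for x
        unfolding eq by (simp add: abs_mult)
      also have "\<dots> x \<le> (real k + \<bar>\<mu>\<bar>) * (\<bar>V x\<bar> * exp (s * T x))" for x
        by (intro mult_right_mono c_dev) auto
      finally show "AE x in M. norm (V x * \<phi> (T x)) \<le> norm ((real k + \<bar>\<mu>\<bar>) * (V x * exp (s * T x)))"
        by (auto simp: abs_mult)
    qed (simp add: \<phi>_def)
    have "(\<integral>x. V x * \<phi> (T x) \<partial>M) = 0"
    proof (rule laplace_zero_imp_orthogonal[OF V T _ \<open>a < b\<close> _ _ int])
      fix r assume "a < r" "r < b"
      then have "r \<in> W" using assms(4) by auto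
      then show "integrable M (\<lambda>x. V x * exp (r * T x))" "(\<integral>x. V x * exp (r * T x) \<partial>M) = 0"
        using V_int V_zero by auto
    qed (simp add: \<phi>_def)
    with int pos[OF s] show "integrable P (\<lambda>x. V x * (c k x * (T x - \<mu>)))" "(\<integral>x. V x * (c k x * (T x - \<mu>)) \<partial>P) = 0"
      by (simp_all add: P_def integrable_exp_family integral_exp_family eq)
  qed
  have truncated: "(\<integral>\<^sup>+x. ennreal (c k x * (T x - \<mu>)\<^sup>2) \<partial>P) \<le> (\<integral>\<^sup>+x. ennreal ((U x - \<mu>)\<^sup>2) \<partial>P)" for k
  proof (cases "integrable P (\<lambda>x. (U x - \<mu>)\<^sup>2)")
    case True
    have c_sq: "c k x * (T x - \<mu>)\<^sup>2 = (c k x * (T x - \<mu>))\<^sup>2" for x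
      by (simp add: c_def indicator_def)
    have int: "integrable P (\<lambda>x. c k x * (T x - \<mu>)\<^sup>2)"
    proof (rule P.integrable_const_bound[where B = "(real k + \<bar>\<mu>\<bar>)\<^sup>2"])
      show "AE x in P. norm (c k x * (T x - \<mu>)\<^sup>2) \<le> (real k + \<bar>\<mu>\<bar>)\<^sup>2"
        unfolding c_sq using c_dev[of k] by (auto intro!: AE_I2 abs_le_square_iff[THEN iffD1])
    qed simp
    have "(\<integral>x. c k x * (T x - \<mu>)\<^sup>2 \<partial>P) = (\<integral>x. c k x * (T x - \<mu>)\<^sup>2 + 2 * (V x * (c k x * (T x - \<mu>))) \<partial>P)"
      using int orth[of k] by simp
    also have "\<dots> \<le> (\<integral>x. (U x - \<mu>)\<^sup>2 \<partial>P)"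
    proof (rule integral_mono)
      fix x
      have "c k x * (T x - \<mu>)\<^sup>2 + 2 * (V x * (c k x * (T x - \<mu>))) = c k x * ((U x - \<mu>)\<^sup>2 - (V x)\<^sup>2)"
        by (simp add: V_def power2_eq_square algebra_simps)
      also have "\<dots> \<le> c k x * (U x - \<mu>)\<^sup>2"
        by (intro mult_left_mono c_bounds) simp
      also have "\<dots> \<le> 1 * (U x - \<mu>)\<^sup>2"
        by (intro mult_right_mono c_bounds) simp
      finally show "c k x * (T x - \<mu>)\<^sup>2 + 2 * (V x * (c k x * (T x - \<mu>))) \<le> (U x - \<mu>)\<^sup>2" by simp
    qed (use int orth[of k] True in auto)
    finally show ?thesis
      using int True c_bounds by (simp add: nn_integral_eq_integral ennreal_leI)
  next
    case False
    then have "(\<integral>\<^sup>+x. ennreal ((U x - \<mu>)\<^sup>2) \<partial>P) = \<infinity>"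
      by (intro nn_integral_nonneg_infinite) auto
    then show ?thesis by simp
  qed
  \<comment> \<open>Monotone convergence removes the truncation, whether or not the limit is
    finite.\<close>
  have "(\<lambda>k. \<integral>\<^sup>+x. ennreal (c k x * (T x - \<mu>)\<^sup>2) \<partial>P) \<longlonglongrightarrow> (\<integral>\<^sup>+x. ennreal ((T x - \<mu>)\<^sup>2) \<partial>P)"
  proof (rule nn_integral_LIMSEQ)
    show "incseq (\<lambda>k x. ennreal (c k x * (T x - \<mu>)\<^sup>2))"
      by (auto simp: incseq_def le_fun_def c_def indicator_def)
    fix x
    obtain K where K: "\<bar>T x\<bar> \<le> real K" using real_arch_simple by blast
    have "\<forall>\<^sub>F k in sequentially. ennreal (c k x * (T x - \<mu>)\<^sup>2) = ennreal ((T x - \<mu>)\<^sup>2)"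
      using eventually_ge_at_top[of K] by eventually_elim (use K in \<open>auto simp: c_def indicator_def\<close>)
    then show "(\<lambda>k. ennreal (c k x * (T x - \<mu>)\<^sup>2)) \<longlonglongrightarrow> ennreal ((T x - \<mu>)\<^sup>2)"
      by (rule tendsto_eventually)
  qed simp
  then have "(\<integral>\<^sup>+x. ennreal ((T x - \<mu>)\<^sup>2) \<partial>P) \<le> (\<integral>\<^sup>+x. ennreal ((U x - \<mu>)\<^sup>2) \<partial>P)"
    by (rule LIMSEQ_le_const2) (use truncated in blast)
  \<comment> \<open>By \<open>mean\<close>, \<open>\<mu>\<close> is also the expectation of
    \<open>U\<close>, so the right side is its variance.\<close>
  then show ?thesis
    using mean[OF s] by (simp add: Var_def P_def \<mu>_def)
qed

section \<open>Derivatives in the natural parameter, end points included\<close>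

text \<open>By convexity of \<open>exp\<close> the quotient increases with \<open>d > 0\<close>, so
  it lies between its limit \<open>t\<close> at 0 and its value at \<open>D\<close>. No exponential
  beyond the parameter \<open>D\<close> enters the bound.\<close>

lemma abs_exp_diff_quotient_le:
  fixes d D t :: real assumes "0 < d" "d \<le> D"
  shows "\<bar>(exp (d * t) - 1) / d\<bar> \<le> \<bar>t\<bar> + \<bar>(exp (D * t) - 1) / D\<bar>"
proof -
  have "exp ((1 - d / D) *\<^sub>R 0 + (d / D) *\<^sub>R (D * t)) \<le> (1 - d / D) * exp 0 + (d / D) * exp (D * t)"
    using assms by (intro convex_onD[OF exp_convex]) auto
  then have "exp (d * t) - 1 \<le> (d / D) * (exp (D * t) - 1)"
    using assms by (simp add: algebra_simps)
  then have "(exp (d * t) - 1) / d \<le> (d / D) * (exp (D * t) - 1) / d"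
    using assms by (intro divide_right_mono) auto
  then have "(exp (d * t) - 1) / d \<le> (exp (D * t) - 1) / D"
    using assms by simp
  moreover have "t \<le> (exp (d * t) - 1) / d"
    using assms exp_ge_add_one_self[of "d * t"] by (simp add: field_simps)
  ultimately show ?thesis by linarith
qed

text \<open>The difference quotients are dominated by means of the derivative at \<open>s\<close>
  and the quotients to the end points \<open>a\<close> and \<open>b\<close>. Parameters outside
  \<open>{a..b}\<close> never enter, so one-sided derivatives are obtained when \<open>s\<close> is
  an end point.\<close>

lemma has_derivative_exp_integral:
  fixes V T :: "'a \<Rightarrow> real"
  assumes [measurable]: "V \<in> borel_measurable M" "T \<in> borel_measurable M"
    and s: "a \<le> s" "s \<le> b"
    and int: "\<And>r. r \<in> {a..b} \<Longrightarrow> integrable M (\<lambda>x. V x * exp (r * T x))"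
    and int_deriv: "integrable M (\<lambda>x. V x * T x * exp (s * T x))"
  shows "((\<lambda>r. \<integral>x. V x * exp (r * T x) \<partial>M) has_real_derivative (\<integral>x. V x * T x * exp (s * T x) \<partial>M))
    (at s within {a..b})"
  unfolding has_field_derivative_iff tendsto_at_iff_sequentially comp_def
proof (intro allI impI)
  fix X :: "nat \<Rightarrow> real"
  assume X: "\<forall>i. X i \<in> {a..b} - {s}" "X \<longlonglongrightarrow> s"
  define q where "q = (\<lambda>d t::real. (exp (d * t) - 1) / d)"
  \<comment> \<open>When \<open>s\<close> is an end point, one of the last two summands is
    \<open>q 0 t\<close>, which is 0 by the convention for division by 0; it belongs to the side
    from which no \<open>d\<close> comes.\<close>
  have q_bound: "\<bar>q d t\<bar> \<le> \<bar>t\<bar> + \<bar>q (b - s) t\<bar> + \<bar>q (a - s) t\<bar>" if "d \<noteq> 0" "s + d \<in> {a..b}" for d t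
  proof (cases "d > 0")
    case True
    then have "\<bar>q d t\<bar> \<le> \<bar>t\<bar> + \<bar>q (b - s) t\<bar>"
      using abs_exp_diff_quotient_le[of d "b - s" t] that by (simp add: q_def)
    then show ?thesis by linarith
  next
    case False
    \<comment> \<open>Negating both \<open>d\<close> and \<open>t\<close> only flips the sign of
      \<open>q\<close>, so negative steps reduce to the bound for positive ones.\<close>
    have q_minus: "\<bar>(exp (- d * - t) - 1) / - d\<bar> = \<bar>q d t\<bar>" for d
      by (simp add: q_def)
    have "\<bar>q d t\<bar> \<le> \<bar>t\<bar> + \<bar>q (a - s) t\<bar>"
      using abs_exp_diff_quotient_le[of "- d" "- (a - s)" "- t"] that False
      unfolding q_minus by simp
    then show ?thesis by linarith
  qed
  \<comment> \<open>Read from left to right, this turns the end point quotients in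
    \<open>dom\<close> into differences of integrable functions. For \<open>d = 0\<close> both sides
    are 0.\<close>
  have split: "V x * exp (s * T x) * q d (T x) = (V x * exp ((s + d) * T x) - V x * exp (s * T x)) / d" for d x
    by (simp add: q_def distrib_right exp_add algebra_simps diff_divide_distrib)
  define dom where "dom = (\<lambda>x. \<bar>V x * T x * exp (s * T x)\<bar> + \<bar>V x * exp (s * T x) * q (b - s) (T x)\<bar>
      + \<bar>V x * exp (s * T x) * q (a - s) (T x)\<bar>)"
  have dom_int: "integrable M dom"
    unfolding dom_def split using int s int_deriv
    by (intro Bochner_Integration.integrable_add integrable_abs integrable_divide Bochner_Integration.integrable_diff) auto
  have "((\<lambda>r. \<integral>x. V x * exp (r * T x) \<partial>M) (X i) - (\<integral>x. V x * exp (s * T x) \<partial>M)) / (X i - s)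
      = (\<integral>x. V x * exp (s * T x) * q (X i - s) (T x) \<partial>M)" for i
    unfolding split using X(1) s int by (subst Bochner_Integration.integral_diff[symmetric]) auto
  moreover have "(\<lambda>i. \<integral>x. V x * exp (s * T x) * q (X i - s) (T x) \<partial>M) \<longlonglongrightarrow> (\<integral>x. V x * T x * exp (s * T x) \<partial>M)"
  proof (rule integral_dominated_convergence[OF _ _ dom_int])
    show "AE x in M. (\<lambda>i. V x * exp (s * T x) * q (X i - s) (T x)) \<longlonglongrightarrow> V x * T x * exp (s * T x)"
    proof (rule AE_I2)
      fix x
      have "((\<lambda>y. exp (y * T x)) has_field_derivative T x) (at 0)"
        by (auto intro!: derivative_eq_intros)
      then have "((\<lambda>y. q y (T x)) \<longlongrightarrow> T x) (at 0)"
        by (simp add: has_field_derivative_iff q_def)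
      then have "(\<lambda>i. q (X i - s) (T x)) \<longlonglongrightarrow> T x"
        using X by (auto simp: tendsto_at_iff_sequentially comp_def LIM_zero_iff)
      then have "(\<lambda>i. V x * exp (s * T x) * q (X i - s) (T x)) \<longlonglongrightarrow> V x * exp (s * T x) * T x"
        by (intro tendsto_intros)
      then show "(\<lambda>i. V x * exp (s * T x) * q (X i - s) (T x)) \<longlonglongrightarrow> V x * T x * exp (s * T x)"
        by (simp add: mult_ac)
    qed
    have "norm (V x * exp (s * T x) * q (X i - s) (T x)) \<le> dom x" for i x
    proof -
      have "norm (V x * exp (s * T x) * q (X i - s) (T x)) = \<bar>V x * exp (s * T x)\<bar> * \<bar>q (X i - s) (T x)\<bar>"
        by (simp add: abs_mult)
      also have "\<dots> \<le> \<bar>V x * exp (s * T x)\<bar> * (\<bar>T x\<bar> + \<bar>q (b - s) (T x)\<bar> + \<bar>q (a - s) (T x)\<bar>)"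
        using X(1) by (intro mult_left_mono q_bound) auto
      finally show ?thesis by (simp add: dom_def abs_mult algebra_simps)
    qed
    then show "AE x in M. norm (V x * exp (s * T x) * q (X i - s) (T x)) \<le> dom x" for i by auto
  qed (simp_all add: q_def)
  ultimately show "(\<lambda>i. ((\<integral>x. V x * exp (X i * T x) \<partial>M) - (\<integral>x. V x * exp (s * T x) \<partial>M)) / (X i - s))
      \<longlonglongrightarrow> (\<integral>x. V x * T x * exp (s * T x) \<partial>M)" by simp
qed

text \<open>An exponential with intermediate exponent is at most the sum of the two outer
  ones.\<close>

lemma integrable_exp_between:
  fixes V T :: "'a \<Rightarrow> real"
  assumes [measurable]: "V \<in> borel_measurable M" "T \<in> borel_measurable M"
    and "integrable M (\<lambda>x. V x * exp (a * T x))" "integrable M (\<lambda>x. V x * exp (b * T x))"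
    and r: "r \<in> {a..b}"
  shows "integrable M (\<lambda>x. V x * exp (r * T x))"
proof (rule Bochner_Integration.integrable_bound)
  show "integrable M (\<lambda>x. \<bar>V x * exp (a * T x)\<bar> + \<bar>V x * exp (b * T x)\<bar>)"
    using assms by simp
  have "exp (r * t) \<le> exp (a * t) + exp (b * t)" for t
  proof (cases "t \<ge> 0")
    case True
    then have "exp (r * t) \<le> exp (b * t)" using r by (simp add: mult_right_mono)
    then show ?thesis using exp_ge_zero[of "a * t"] by linarith
  next
    case False
    then have "exp (r * t) \<le> exp (a * t)" using r by (simp add: mult_right_mono_neg)
    then show ?thesis using exp_ge_zero[of "b * t"] by linarith
  qed
  then have "\<bar>V x\<bar> * exp (r * T x) \<le> \<bar>V x\<bar> * (exp (a * T x) + exp (b * T x))" for x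
    by (intro mult_left_mono) auto
  then show "AE x in M. norm (V x * exp (r * T x)) \<le> norm (\<bar>V x * exp (a * T x)\<bar> + \<bar>V x * exp (b * T x)\<bar>)"
    by (auto simp: abs_mult distrib_left)
qed simp

text \<open>Both formulas come from differentiating under the integral, with weights 1 and
  \<open>T\<close>; they are the first two cumulants. Derivatives are taken within
  \<open>{a..b}\<close> because \<open>s\<close> may be an end point of the natural parameter set,
  where the second moment has to come from \<open>finite_var\<close>.\<close>

lemma exp_family_derivatives:
  fixes T :: "'a \<Rightarrow> real"
  assumes T [measurable]: "T \<in> borel_measurable M" and nonnull: "emeasure M (space M) \<noteq> 0"
    and s: "a \<le> s" "s \<le> b"
    and int_exp: "\<And>r. r \<in> {a, s, b} \<Longrightarrow> integrable M (\<lambda>x. exp (r * T x))"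
    and int_T: "\<And>r. r \<in> {a, s, b} \<Longrightarrow> integrable (exp_family M T r) T"
    and finite_var: "Var (exp_family M T s) T = ennreal v" and "0 \<le> v"
  shows "((\<lambda>r. ln (partition_fun M T r)) has_real_derivative (\<integral>x. T x \<partial>exp_family M T s)) (at s within {a..b})"
    and "((\<lambda>r. \<integral>x. T x \<partial>exp_family M T r) has_real_derivative v) (at s within {a..b})"
proof -
  define P where "P = exp_family M T s"
  define \<mu> where "\<mu> = (\<integral>x. T x \<partial>P)"
  note pos = partition_fun_pos[OF _ nonnull]
  have sets_P [measurable_cong]: "sets P = sets M" by (simp add: P_def)
  interpret P: prob_space P
    unfolding P_def by (intro prob_space_exp_family int_exp pos T) auto
  have int_exp': "integrable M (\<lambda>x. exp (r * T x))" if "r \<in> {a..b}" for r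
    using integrable_exp_between[of "\<lambda>_. 1" M T a b r] int_exp that by simp
  have int_T': "integrable M (\<lambda>x. T x * exp (r * T x))" if "r \<in> {a..b}" for r
    using integrable_exp_between[of T M T a b r] int_exp int_T that by (simp add: integrable_exp_family pos)
  have int_dev: "integrable P (\<lambda>x. (T x - \<mu>)\<^sup>2)"
    using finite_var unfolding Var_def
    by (intro integrableI_nonneg) (auto simp: P_def \<mu>_def)
  have v: "(\<integral>x. (T x - \<mu>)\<^sup>2 \<partial>P) = v"
  proof -
    have "ennreal (\<integral>x. (T x - \<mu>)\<^sup>2 \<partial>P) = ennreal v"
      using nn_integral_eq_integral[OF int_dev] finite_var by (simp add: Var_def P_def \<mu>_def)
    then show ?thesis using \<open>0 \<le> v\<close> by (simp add: Bochner_Integration.integral_nonneg)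
  qed
  have int_T_P: "integrable P T" unfolding P_def by (rule int_T) simp
  \<comment> \<open>This integrand is \<open>(T x)\<^sup>2\<close> expanded around the mean.\<close>
  have "integrable P (\<lambda>x. (T x - \<mu>)\<^sup>2 + 2 * \<mu> * T x - \<mu>\<^sup>2)"
    using int_dev int_T_P by simp
  then have int_sq: "integrable P (\<lambda>x. (T x)\<^sup>2)"
    by (simp add: power2_eq_square algebra_simps)
  have v_eq: "v = (\<integral>x. (T x)\<^sup>2 \<partial>P) - \<mu>\<^sup>2"
    using P.variance_eq[OF int_T_P int_sq] v by (simp add: \<mu>_def)
  define Z where "Z = partition_fun M T"
  have Z_pos: "0 < Z s" using pos int_exp s by (simp add: Z_def)
  have Z_deriv: "(Z has_real_derivative \<mu> * Z s) (at s within {a..b})"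
    using has_derivative_exp_integral[of "\<lambda>_. 1" M T a s b] s int_exp' int_T' Z_pos
    by (simp add: Z_def \<mu>_def P_def integral_exp_family partition_fun_def[abs_def])
  then show "((\<lambda>r. ln (partition_fun M T r)) has_real_derivative (\<integral>x. T x \<partial>exp_family M T s)) (at s within {a..b})"
    using Z_pos by (auto intro!: derivative_eq_intros simp: Z_def \<mu>_def P_def)
  have "((\<lambda>r. \<integral>x. T x * exp (r * T x) \<partial>M) has_real_derivative (\<integral>x. (T x)\<^sup>2 \<partial>P) * Z s) (at s within {a..b})"
    using has_derivative_exp_integral[of T M T a s b] s int_T' Z_pos int_sq
    by (simp add: Z_def P_def integral_exp_family integrable_exp_family power2_eq_square)
  moreover have "(\<integral>x. T x * exp (s * T x) \<partial>M) = \<mu> * Z s"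
    using Z_pos by (simp add: \<mu>_def P_def integral_exp_family Z_def)
  \<comment> \<open>By the quotient rule the derivative is the second moment minus
    \<open>\<mu>\<^sup>2\<close>.\<close>
  ultimately have "((\<lambda>r. (\<integral>x. T x * exp (r * T x) \<partial>M) / Z r) has_real_derivative v) (at s within {a..b})"
    using Z_pos by (auto intro!: derivative_eq_intros Z_deriv simp: v_eq field_simps power2_eq_square)
  then show "((\<lambda>r. \<integral>x. T x \<partial>exp_family M T r) has_real_derivative v) (at s within {a..b})"
    by (simp add: integral_exp_family Z_def)
qed

section \<open>Affine statistics and nondegeneracy of the family\<close>

lemma Var_cong:
  assumes "\<And>x. x \<in> space M \<Longrightarrow> X x = Y x"
  shows "Var M X = Var M Y"
proof -
  have "(\<integral>x. X x \<partial>M) = (\<integral>x. Y x \<partial>M)"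
    using assms by (intro Bochner_Integration.integral_cong) auto
  then show ?thesis
    unfolding Var_def using assms by (intro nn_integral_cong) auto
qed

lemma (in prob_space) Var_affine:
  assumes int: "integrable M X"
  shows "Var M (\<lambda>x. r * (X x - m)) = ennreal (r\<^sup>2) * Var M X"
proof -
  have [measurable]: "X \<in> borel_measurable M" using int by auto
  have "(\<integral>x. r * (X x - m) \<partial>M) = r * ((\<integral>x. X x \<partial>M) - m)"
    using int by (simp add: prob_space)
  then have "r * (X x - m) - (\<integral>x. r * (X x - m) \<partial>M) = r * (X x - (\<integral>x. X x \<partial>M))" for x
    by (simp only:) (simp add: algebra_simps)
  then have "Var M (\<lambda>x. r * (X x - m)) = (\<integral>\<^sup>+x. ennreal (r\<^sup>2) * ennreal ((X x - (\<integral>x. X x \<partial>M))\<^sup>2) \<partial>M)"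
    unfolding Var_def by (simp only: power_mult_distrib ennreal_mult' zero_le_power2)
  also have "\<dots> = ennreal (r\<^sup>2) * Var M X"
    unfolding Var_def by (rule nn_integral_cmult) measurable
  finally show ?thesis .
qed

text \<open>A constant \<open>u = k\<close> would satisfy the nontrivial relation with coefficients
  \<open>k\<close> and \<open>-1\<close>.\<close>

lemma lin_indep_on_one_obtains:
  assumes "lin_indep_on A (\<lambda>_. 1) u"
  obtains x y where "x \<in> A" "y \<in> A" "u x < u y"
proof -
  have "\<exists>x\<in>A. \<exists>y\<in>A. u x \<noteq> u y"
  proof (rule ccontr)
    assume "\<not> (\<exists>x\<in>A. \<exists>y\<in>A. u x \<noteq> u y)"
    then obtain k where "\<forall>t\<in>A. u t = k" by blast
    then have "\<forall>t\<in>A. k * 1 + (- 1) * u t = 0" by simp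
    with assms have "k = 0 \<and> (- 1 :: real) = 0"
      unfolding lin_indep_on_def by blast
    then show False by simp
  qed
  then obtain x y where xy: "x \<in> A" "y \<in> A" "u x \<noteq> u y" by blast
  then show thesis
    using that[of x y] that[of y x] by (cases "u x < u y") simp_all
qed

lemma sample_space_nonnull:
  assumes S: "S \<in> sets borel" and "emeasure lborel S \<noteq> 0"
  shows "emeasure (sample_space S n) (space (sample_space S n)) \<noteq> 0"
proof -
  have "sigma_finite_measure (restrict_space lborel S)"
    using S by (intro sigma_finite_measure_restrict_space lborel.sigma_finite_measure_axioms) simp
  then interpret product_sigma_finite "\<lambda>_::nat. restrict_space lborel S"
    by (simp add: product_sigma_finite_def)
  have "emeasure (sample_space S n) (space (sample_space S n)) = (\<Prod>i<n. emeasure (restrict_space lborel S) (space (restrict_space lborel S)))"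
    unfolding sample_space_def space_PiM by (intro emeasure_PiM) auto
  also have "emeasure (restrict_space lborel S) (space (restrict_space lborel S)) = emeasure lborel S"
    using S by (subst emeasure_restrict_space) (auto simp: space_restrict_space)
  finally show ?thesis using assms by simp
qed

text \<open>A density supported on a null set would integrate to 0 instead of 1. This later keeps
  the partition function from vanishing.\<close>

lemma regular_B_family_support_nonnull:
  assumes "regular_B_family \<alpha> \<Theta> S h f w F" "\<Theta> \<noteq> {}"
  shows "emeasure lborel S \<noteq> 0"
proof
  assume "emeasure lborel S = 0"
  obtain \<theta> where \<theta>: "\<theta> \<in> \<Theta>" using assms(2) by blast
  have S: "S \<in> sets lborel" and int: "has_bochner_integral lborel (B_density \<alpha> S h f w F \<theta>) 1"
    using assms(1) \<theta> by (auto simp: regular_B_family_def)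
  have "AE x in lborel. x \<notin> S"
    using S \<open>emeasure lborel S = 0\<close> by (intro AE_not_in) (simp add: null_sets_def)
  then have "AE x in lborel. B_density \<alpha> S h f w F \<theta> x = 0"
    by eventually_elim (simp add: B_density_def)
  then have "(\<integral>x. B_density \<alpha> S h f w F \<theta> x \<partial>lborel) = 0"
    by (rule integral_eq_zero_AE)
  with int show False by (simp add: has_bochner_integral_iff)
qed

section \<open>Factorization of the deformed weight\<close>

lemma B_density_powr:
  assumes "\<alpha> \<noteq> 1" "x \<in> S" "0 \<le> h x + F \<theta> + w \<theta> * f x"
  shows "B_density \<alpha> S h f w F \<theta> x powr (\<alpha> - 1) = h x + F \<theta> + w \<theta> * f x"
  using assms by (simp add: B_density_def powr_powr)

text \<open>Raising the density to the power \<open>\<alpha> - 1\<close> undoes its exponent. The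
  weight then splits into a factor in \<open>\<theta>\<close> alone, which normalization removes, a
  factor in \<open>x\<close> alone, which can join the base measure, and an exponential tilt along
  the mean of \<open>f\<close>.\<close>

lemma deformed_weight_factor:
  assumes "\<alpha> \<noteq> 1" "n \<ge> 1" "regular_B_family \<alpha> \<Theta> S h f w F" "\<theta> \<in> \<Theta>" "x \<in> space (sample_space S n)"
  shows "deformed_weight \<alpha> (B_density \<alpha> S h f w F) n \<theta> x =
    exp (\<alpha> / (\<alpha> - 1) * F \<theta>) *
    (exp (\<alpha> / (\<alpha> - 1) * sample_mean h n x) * exp (\<alpha> / (\<alpha> - 1) * w \<theta> * sample_mean f n x))"
proof -
  have x: "x i \<in> S" if "i < n" for i
    using assms(5) that by (auto simp: sample_space_def space_PiM space_restrict_space PiE_iff)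
  have "(\<Sum>i<n. B_density \<alpha> S h f w F \<theta> (x i) powr (\<alpha> - 1)) = (\<Sum>i<n. h (x i) + F \<theta> + w \<theta> * f (x i))"
    using assms x by (intro sum.cong B_density_powr) (auto simp: regular_B_family_def)
  also have "\<dots> = (\<Sum>i<n. h (x i)) + real n * F \<theta> + w \<theta> * (\<Sum>i<n. f (x i))"
    by (simp add: sum.distrib sum_distrib_left)
  also have "\<dots> = real n * (sample_mean h n x + F \<theta> + w \<theta> * sample_mean f n x)"
    using assms(2) unfolding sample_mean_def by (simp add: distrib_left)
  finally have "\<alpha> / (real n * (\<alpha> - 1)) * (\<Sum>i<n. B_density \<alpha> S h f w F \<theta> (x i) powr (\<alpha> - 1))
      = \<alpha> / (\<alpha> - 1) * (sample_mean h n x + F \<theta> + w \<theta> * sample_mean f n x)"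
    using assms(1,2) by (simp add: field_simps)
  then show ?thesis
    unfolding deformed_weight_def by (simp add: algebra_simps flip: exp_add)
qed

section \<open>Best estimator and information bound for the deformed family\<close>

text \<open>The hypothesis \<open>nonconst\<close> is there because \<open>\<Theta>\<close> may be
  disconnected: if \<open>w\<close> were constant on each component, the natural parameters would
  contain no interval and completeness could fail. On a connected \<open>\<Theta>\<close>,
  regularity provides the witness \<open>J = \<Theta>\<close>.\<close>

theorem theorem22:
  fixes \<alpha> :: real and \<Theta> S :: "real set" and h f w F :: "real \<Rightarrow> real" and n :: nat
    and p :: "real \<Rightarrow> real \<Rightarrow> real" and P :: "real \<Rightarrow> (nat \<Rightarrow> real) measure"
    and \<tau> :: "real \<Rightarrow> real"
  defines "p \<equiv> B_density \<alpha> S h f w F"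
    and "P \<equiv> deformed_distr \<alpha> S p n"
    and "\<tau> \<equiv> (\<lambda>\<theta>. \<integral>x. sample_mean f n x \<partial>P \<theta>)"
  assumes "\<alpha> > 0" and "\<alpha> \<noteq> 1" and "n \<ge> 1"
    and regular: "regular_B_family \<alpha> \<Theta> S h f w F"
    and nonconst: "\<exists>J\<subseteq>\<Theta>. connected J \<and> lin_indep_on J (\<lambda>_. 1) w"
    and finite_denominator: "\<forall>\<theta>\<in>\<Theta>. integrable (sample_space S n) (deformed_weight \<alpha> p n \<theta>)"
    and mean_exists: "\<forall>\<theta>\<in>\<Theta>. integrable (P \<theta>) (sample_mean f n)"
  shows "best_estimator_of_mean P \<Theta> (sample_mean f n) \<and>
    (\<forall>U. has_expectation P \<Theta> U \<tau> \<longrightarrow>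
      (\<forall>\<theta>\<in>\<Theta>. Var (P \<theta>) U \<ge> ennreal ((deriv \<tau> \<theta>)\<^sup>2) / deformed_fisher_info \<alpha> S p n \<theta>))"
proof -
  define c where "c = \<alpha> / (\<alpha> - 1)"
  define T where "T = sample_mean f n"
  define M\<^sub>0 where "M\<^sub>0 = sample_space S n"
  \<comment> \<open>\<open>H\<close> is the factor of the weight that is free of
    \<open>\<theta>\<close>; as a density it turns the Lebesgue product into the base measure
    \<open>M\<close>.\<close>
  define H where "H = (\<lambda>x. exp (c * sample_mean h n x))"
  define M where "M = density M\<^sub>0 (\<lambda>x. ennreal (H x))"
  define s where "s = (\<lambda>\<theta>. c * w \<theta>)"
  define Z where "Z = partition_fun M T"
  have "c \<noteq> 0" using \<open>\<alpha> > 0\<close> \<open>\<alpha> \<noteq> 1\<close> by (simp add: c_def)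
  have open_\<Theta>: "open \<Theta>" and S: "S \<in> sets borel" and w: "w differentiable_on \<Theta>"
    using regular by (auto simp: regular_B_family_def)
  obtain J where J: "J \<subseteq> \<Theta>" "connected J" "lin_indep_on J (\<lambda>_. 1) w"
    using nonconst by blast
  obtain t\<^sub>1 t\<^sub>2 where t12: "t\<^sub>1 \<in> J" "t\<^sub>2 \<in> J" "w t\<^sub>1 < w t\<^sub>2"
    using lin_indep_on_one_obtains[OF J(3)] .
  have "t\<^sub>1 \<in> \<Theta>" using t12 J by blast

  have weight: "deformed_weight \<alpha> p n \<theta> x = exp (c * F \<theta>) * (H x * exp (s \<theta> * T x))"
    if "\<theta> \<in> \<Theta>" "x \<in> space M\<^sub>0" for \<theta> x
    using deformed_weight_factor[OF \<open>\<alpha> \<noteq> 1\<close> \<open>n \<ge> 1\<close> regular that(1)] that(2)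
    by (simp add: p_def c_def H_def s_def T_def M\<^sub>0_def)
  \<comment> \<open>Measurability of \<open>T\<close> is inherited from the existence of its mean at
    \<open>t\<^sub>1\<close>; that of \<open>H\<close> then follows by dividing the weight at
    \<open>t\<^sub>1\<close> by its other factors.\<close>
  have T_meas [measurable]: "T \<in> borel_measurable M\<^sub>0"
    using mean_exists \<open>t\<^sub>1 \<in> \<Theta>\<close> borel_measurable_integrable[of "P t\<^sub>1" T]
    by (simp add: P_def deformed_distr_def T_def M\<^sub>0_def)
  have H_meas [measurable]: "H \<in> borel_measurable M\<^sub>0"
  proof -
    have [measurable]: "deformed_weight \<alpha> p n t\<^sub>1 \<in> borel_measurable M\<^sub>0"
      using finite_denominator \<open>t\<^sub>1 \<in> \<Theta>\<close> by (auto simp: M\<^sub>0_def)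
    have "(\<lambda>x. deformed_weight \<alpha> p n t\<^sub>1 x / (exp (c * F t\<^sub>1) * exp (s t\<^sub>1 * T x))) \<in> borel_measurable M\<^sub>0"
      by measurable
    then show ?thesis
      by (rule measurable_cong[THEN iffD1, rotated]) (simp add: weight[OF \<open>t\<^sub>1 \<in> \<Theta>\<close>])
  qed
  have H_pos: "0 < H x" for x by (simp add: H_def)
  have sets_M [measurable_cong]: "sets M = sets M\<^sub>0" by (simp add: M_def)
  have T_meas_M: "T \<in> borel_measurable M" by measurable
  have nonnull: "emeasure M (space M) \<noteq> 0"
  proof -
    have "emeasure M\<^sub>0 (space M\<^sub>0) \<noteq> 0"
      unfolding M\<^sub>0_def using regular_B_family_support_nonnull[OF regular] \<open>t\<^sub>1 \<in> \<Theta>\<close>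
      by (intro sample_space_nonnull S) auto
    moreover have "emeasure M (space M) = (\<integral>\<^sup>+x. ennreal (H x) \<partial>M\<^sub>0)"
      unfolding M_def by (simp add: emeasure_density cong: nn_integral_cong)
    moreover have "ennreal (H x) \<noteq> 0" for x
      using H_pos[of x] by (simp add: ennreal_eq_0_iff)
    ultimately show ?thesis
      by (simp add: nn_integral_0_iff_AE AE_iff_measurable[of "space M\<^sub>0" M\<^sub>0 "\<lambda>_. False"])
  qed
  have int_exp: "integrable M (\<lambda>x. exp (s \<theta> * T x))" if "\<theta> \<in> \<Theta>" for \<theta>
  proof -
    have "integrable M\<^sub>0 (\<lambda>x. exp (c * F \<theta>) * (H x * exp (s \<theta> * T x)))"
      using finite_denominator that weight[OF that]
      by (subst Bochner_Integration.integrable_cong[OF refl weight[OF that, symmetric]])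
        (auto simp: M\<^sub>0_def)
    then show ?thesis
      unfolding M_def using H_pos by (subst integrable_density) (auto intro: less_imp_le)
  qed
  have Z_pos: "0 < Z (s \<theta>)" if "\<theta> \<in> \<Theta>" for \<theta>
    unfolding Z_def using partition_fun_pos[OF int_exp[OF that] nonnull] .
  have density_eq: "deformed_density \<alpha> S p n \<theta> x = H x * exp (s \<theta> * T x) / Z (s \<theta>)"
    if "\<theta> \<in> \<Theta>" "x \<in> space M\<^sub>0" for \<theta> x
  proof -
    have "(\<integral>y. deformed_weight \<alpha> p n \<theta> y \<partial>sample_space S n) = (\<integral>y. exp (c * F \<theta>) * (H y * exp (s \<theta> * T y)) \<partial>M\<^sub>0)"
      unfolding M\<^sub>0_def[symmetric] by (intro Bochner_Integration.integral_cong) (auto simp: weight that)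
    also have "\<dots> = exp (c * F \<theta>) * Z (s \<theta>)"
      unfolding Z_def partition_fun_def M_def using H_pos
      by (subst integral_density) (auto intro: less_imp_le)
    finally show ?thesis
      unfolding deformed_density_def by (simp add: weight that)
  qed
  have P_eq: "P \<theta> = exp_family M T (s \<theta>)" if "\<theta> \<in> \<Theta>" for \<theta>
  proof -
    have "P \<theta> = density M\<^sub>0 (\<lambda>x. ennreal (H x) * ennreal (exp (s \<theta> * T x) / Z (s \<theta>)))"
      unfolding P_def deformed_distr_def M\<^sub>0_def[symmetric]
    proof (rule density_cong)
      show "AE x in M\<^sub>0. ennreal (deformed_density \<alpha> S p n \<theta> x) = ennreal (H x) * ennreal (exp (s \<theta> * T x) / Z (s \<theta>))"
        using Z_pos[OF that] H_pos
        by (intro AE_I2) (simp add: density_eq that less_imp_le flip: ennreal_mult)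
      have "(\<lambda>x. H x * exp (s \<theta> * T x) / Z (s \<theta>)) \<in> borel_measurable M\<^sub>0" by measurable
      then have "deformed_density \<alpha> S p n \<theta> \<in> borel_measurable M\<^sub>0"
        by (rule measurable_cong[THEN iffD1, rotated]) (simp add: density_eq that)
      then show "(\<lambda>x. ennreal (deformed_density \<alpha> S p n \<theta> x)) \<in> borel_measurable M\<^sub>0" by measurable
    qed measurable
    also have "\<dots> = exp_family M T (s \<theta>)"
      unfolding exp_family_def M_def Z_def by (subst density_density_eq) (auto simp: M_def)
    finally show ?thesis .
  qed
  have int_T: "integrable (exp_family M T (s \<theta>)) T" if "\<theta> \<in> \<Theta>" for \<theta>
    using mean_exists[folded T_def, rule_format, OF that] by (simp only: P_eq[OF that])
  have \<tau>_eq: "\<tau> \<theta> = (\<integral>x. T x \<partial>exp_family M T (s \<theta>))" if "\<theta> \<in> \<Theta>" for \<theta>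
    by (simp only: \<tau>_def T_def[symmetric] P_eq[OF that])

  \<comment> \<open>Here \<open>nonconst\<close> enters: the continuous image of the connected set
    \<open>J\<close> is connected and contains two distinct values.\<close>
  obtain a b where ab: "a < b" "{a<..<b} \<subseteq> s ` \<Theta>"
  proof -
    have "continuous_on J s"
      unfolding s_def using differentiable_imp_continuous_on[OF w] J(1)
      by (intro continuous_intros) (rule continuous_on_subset)
    then have conn: "connected (s ` J)" using J(2) by (rule connected_continuous_image)
    \<comment> \<open>For \<open>\<alpha> < 1\<close> the factor \<open>c\<close> is negative and
      reverses the order of the values of \<open>w\<close>, hence \<open>min\<close> and
      \<open>max\<close>.\<close>
    define a b where "a = min (s t\<^sub>1) (s t\<^sub>2)" and "b = max (s t\<^sub>1) (s t\<^sub>2)"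
    have "s t\<^sub>1 \<noteq> s t\<^sub>2" using t12 \<open>c \<noteq> 0\<close> by (simp add: s_def)
    then have "a < b" by (auto simp: a_def b_def)
    have "{a..b} \<subseteq> s ` J"
      using t12 by (intro connected_contains_Icc[OF conn]) (auto simp: a_def b_def min_def max_def)
    also have "s ` J \<subseteq> s ` \<Theta>" using J(1) by (rule image_mono)
    finally have "{a..b} \<subseteq> s ` \<Theta>" .
    then have "{a<..<b} \<subseteq> s ` \<Theta>"
      using greaterThanLessThan_subseteq_atLeastAtMost_iff[of a b a b] by (meson order_refl order_trans)
    with \<open>a < b\<close> show thesis by (rule that)
  qed
  have best: "Var (P \<theta>) T \<le> Var (P \<theta>) U" if U: "has_expectation P \<Theta> U \<tau>" and "\<theta> \<in> \<Theta>" for U \<theta>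
    unfolding P_eq[OF \<open>\<theta> \<in> \<Theta>\<close>]
  proof (rule exp_family_best_estimator[OF T_meas_M nonnull ab])
    show "integrable (exp_family M T r) U" "(\<integral>x. U x \<partial>exp_family M T r) = (\<integral>x. T x \<partial>exp_family M T r)"
      if r: "r \<in> s ` \<Theta>" for r
    proof -
      obtain t where t: "t \<in> \<Theta>" "r = s t" using r by blast
      have "integrable (P t) U" "(\<integral>x. U x \<partial>P t) = (\<integral>x. T x \<partial>P t)"
        using U t(1) by (simp_all add: has_expectation_def \<tau>_def T_def)
      then show "integrable (exp_family M T r) U" "(\<integral>x. U x \<partial>exp_family M T r) = (\<integral>x. T x \<partial>exp_family M T r)"
        unfolding P_eq[OF t(1)] t(2) .
    qed
  qed (use int_exp int_T \<open>\<theta> \<in> \<Theta>\<close> in auto)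

  \<comment> \<open>It suffices to compare the bound with the variance of \<open>T\<close>, since by
    \<open>best\<close> that variance lies below the one of any competing \<open>U\<close>.\<close>
  have cramer_rao: "ennreal ((deriv \<tau> \<theta>)\<^sup>2) / deformed_fisher_info \<alpha> S p n \<theta> \<le> Var (P \<theta>) T"
    if \<theta>: "\<theta> \<in> \<Theta>" and fin: "Var (P \<theta>) T \<noteq> \<infinity>" for \<theta>
  proof -
    obtain v where v: "Var (P \<theta>) T = ennreal v" "0 \<le> v"
      using fin by (cases "Var (P \<theta>) T") auto
    define \<mu> where "\<mu> = (\<integral>x. T x \<partial>P \<theta>)"
    \<comment> \<open>The natural parameter \<open>s \<theta>\<close> may be an endpoint of the set of natural parameters. Then
      only one-sided derivatives in \<open>s\<close> exist, and \<open>a\<close> or \<open>b\<close> is \<open>s \<theta>\<close> itself.\<close>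
    obtain a where a: "a \<in> s ` \<Theta>" "a \<le> s \<theta>" "a = s \<theta> \<Longrightarrow> \<forall>t\<in>\<Theta>. s \<theta> \<le> s t"
    proof (cases "\<exists>t\<in>\<Theta>. s t < s \<theta>")
      case True
      then show thesis using that by fastforce
    next
      case False
      then show thesis using that[of "s \<theta>"] \<theta> by (auto simp: not_less)
    qed
    obtain b where b: "b \<in> s ` \<Theta>" "s \<theta> \<le> b" "b = s \<theta> \<Longrightarrow> \<forall>t\<in>\<Theta>. s t \<le> s \<theta>"
    proof (cases "\<exists>t\<in>\<Theta>. s \<theta> < s t")
      case True
      then show thesis using that by fastforce
    next
      case False
      then show thesis using that[of "s \<theta>"] \<theta> by (auto simp: not_less)
    qed
    have ints: "integrable M (\<lambda>x. exp (r * T x))" "integrable (exp_family M T r) T"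
      if "r \<in> {a, s \<theta>, b}" for r
      using that a(1) b(1) \<theta> int_exp int_T by auto
    have var: "Var (exp_family M T (s \<theta>)) T = ennreal v"
      using v(1) by (simp only: P_eq[OF \<theta>])
    have derivs: "((\<lambda>r. ln (Z r)) has_real_derivative \<mu>) (at (s \<theta>) within {a..b})"
        "((\<lambda>r. \<integral>x. T x \<partial>exp_family M T r) has_real_derivative v) (at (s \<theta>) within {a..b})"
      using exp_family_derivatives[OF T_meas_M nonnull a(2) b(2) ints var v(2)]
      by (simp_all only: Z_def \<mu>_def P_eq[OF \<theta>])
    have "w differentiable at \<theta>"
      using w \<theta> open_\<Theta> by (simp add: differentiable_on_eq_differentiable_at)
    then obtain d where "(w has_real_derivative d) (at \<theta>)"
      by (rule real_differentiableE)
    then have s_deriv: "(s has_real_derivative c * d) (at \<theta>)"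
      unfolding s_def by (auto intro!: derivative_eq_intros)
    \<comment> \<open>A whole neighbourhood of \<open>\<theta>\<close> is mapped into
      \<open>{a..b}\<close>: on each side by continuity if the end point differs from
      \<open>s \<theta>\<close>, and otherwise because \<open>s \<theta>\<close> is extremal on
      \<open>\<Theta>\<close>.\<close>
    define N where "N = {t \<in> \<Theta>. s t \<in> {a..b}}"
    have "\<forall>\<^sub>F t in nhds \<theta>. t \<in> N"
    proof -
      have lim: "(s \<longlongrightarrow> s \<theta>) (nhds \<theta>)"
        using DERIV_isCont[OF s_deriv] by (simp add: isCont_def tendsto_at_iff_tendsto_nhds)
      have "\<forall>\<^sub>F t in nhds \<theta>. t \<in> \<Theta>" using open_\<Theta> \<theta> by (simp add: eventually_nhds_in_open)
      moreover have "\<forall>\<^sub>F t in nhds \<theta>. t \<in> \<Theta> \<longrightarrow> a \<le> s t"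
      proof (cases "a = s \<theta>")
        case False
        with a(2) have "a < s \<theta>" by simp
        from order_tendstoD(1)[OF lim this] show ?thesis by eventually_elim simp
      qed (use a(3) in simp)
      moreover have "\<forall>\<^sub>F t in nhds \<theta>. t \<in> \<Theta> \<longrightarrow> s t \<le> b"
      proof (cases "b = s \<theta>")
        case False
        with b(2) have "s \<theta> < b" by simp
        from order_tendstoD(2)[OF lim this] show ?thesis by eventually_elim simp
      qed (use b(3) in simp)
      ultimately show ?thesis by eventually_elim (simp add: N_def)
    qed
    then obtain N' where N': "open N'" "\<theta> \<in> N'" "N' \<subseteq> N"
      by (auto simp: eventually_nhds)
    \<comment> \<open>The outer derivative exists only within \<open>{a..b}\<close>, but
      \<open>s\<close> stays there near \<open>\<theta>\<close>, so the composition has a two-sided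
      derivative in \<open>\<theta>\<close>.\<close>
    have chain: "((\<lambda>t. g (s t)) has_real_derivative D * (c * d)) (at \<theta>)"
      if "(g has_real_derivative D) (at (s \<theta>) within {a..b})" for g D
    proof -
      have "(g has_real_derivative D) (at (s \<theta>) within s ` N')"
        using N'(3) by (intro has_field_derivative_subset[OF that]) (auto simp: N_def)
      from DERIV_image_chain[OF this has_field_derivative_at_within[OF s_deriv]]
      have "(g \<circ> s has_real_derivative D * (c * d)) (at \<theta> within N')" .
      then show ?thesis by (simp only: at_within_open[OF N'(2,1)] comp_def)
    qed
    have "(\<tau> has_real_derivative v * (c * d)) (at \<theta>)"
      by (rule has_field_derivative_transform_within_open[OF chain[OF derivs(2)] open_\<Theta> \<theta>]) (simp add: \<tau>_eq)
    then have \<tau>_deriv: "deriv \<tau> \<theta> = v * (c * d)" by (rule DERIV_imp_deriv)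
    have score: "deriv (\<lambda>t. ln (deformed_density \<alpha> S p n t x)) \<theta> = c * d * (T x - \<mu>)" if x: "x \<in> space M\<^sub>0" for x
    proof (rule DERIV_imp_deriv)
      have "((\<lambda>t. ln (H x) + s t * T x - ln (Z (s t))) has_real_derivative c * d * (T x - \<mu>)) (at \<theta>)"
        by (rule DERIV_cong[OF DERIV_diff[OF DERIV_add[OF DERIV_const DERIV_cmult_right[OF s_deriv]]
          chain[OF derivs(1)]]]) (simp add: algebra_simps)
      then show "((\<lambda>t. ln (deformed_density \<alpha> S p n t x)) has_real_derivative c * d * (T x - \<mu>)) (at \<theta>)"
      proof (rule has_field_derivative_transform_within_open[OF _ open_\<Theta> \<theta>])
        fix t assume "t \<in> \<Theta>"
        then show "ln (H x) + s t * T x - ln (Z (s t)) = ln (deformed_density \<alpha> S p n t x)"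
          using x H_pos[of x] Z_pos[of t] by (simp add: density_eq ln_div ln_mult)
      qed
    qed
    interpret P: prob_space "P \<theta>"
      unfolding P_eq[OF \<theta>] using \<theta> Z_pos by (intro prob_space_exp_family T_meas_M int_exp) (auto simp: Z_def)
    have "deformed_fisher_info \<alpha> S p n \<theta> = Var (P \<theta>) (\<lambda>x. c * d * (T x - \<mu>))"
      unfolding deformed_fisher_info_def P_def[symmetric]
      by (rule Var_cong) (simp add: score P_eq \<theta> M_def)
    also have "\<dots> = ennreal ((c * d)\<^sup>2) * Var (P \<theta>) T"
      using int_T \<theta> by (intro P.Var_affine) (simp add: P_eq)
    also have "\<dots> = ennreal ((c * d)\<^sup>2 * v)"
      using v by (simp add: ennreal_mult)
    finally have info: "deformed_fisher_info \<alpha> S p n \<theta> = ennreal ((c * d)\<^sup>2 * v)" .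
    show ?thesis
    \<comment> \<open>Zero information means \<open>c * d = 0\<close> or \<open>v = 0\<close>. Then
      \<open>deriv \<tau> \<theta>\<close> is 0 as well, and the bound \<open>0 / 0\<close> is 0 in
      \<open>ennreal\<close>.\<close>
    proof (cases "(c * d)\<^sup>2 * v = 0")
      case True
      then show ?thesis by (auto simp: \<tau>_deriv)
    next
      case False
      then have "0 < (c * d)\<^sup>2 * v" using v(2) by (simp add: less_le)
      moreover have "(v * (c * d))\<^sup>2 / ((c * d)\<^sup>2 * v) = v"
        using False by (simp add: power2_eq_square)
      ultimately show ?thesis
        unfolding info \<tau>_deriv v(1) by (simp add: divide_ennreal)
    qed
  qed
  show ?thesis
    unfolding best_estimator_of_mean_def \<tau>_def[symmetric]
  proof (intro conjI allI impI ballI)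
    fix U \<theta> assume U: "has_expectation P \<Theta> U \<tau>" "\<theta> \<in> \<Theta>"
    show "Var (P \<theta>) (sample_mean f n) \<le> Var (P \<theta>) U"
      using best[OF U] by (simp add: T_def)
    show "ennreal ((deriv \<tau> \<theta>)\<^sup>2) / deformed_fisher_info \<alpha> S p n \<theta> \<le> Var (P \<theta>) U"
    proof (cases "Var (P \<theta>) T = \<infinity>")
      case True
      \<comment> \<open>Here \<open>\<tau>\<close> need not be differentiable, so \<open>deriv \<tau> \<theta>\<close> may be a junk value.\<close>
      then show ?thesis using best[OF U] by (simp add: top_unique)
    next
      case False
      then show ?thesis using cramer_rao[OF U(2)] best[OF U] by (meson order_trans)
    qed
  qed
qed

end
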